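(* Let $\mathbb K$ be a field of characteristic $0$. Let $\phi:\mathsf{Rio}\to\mathbb K[L]$ be an algebra morphism and let $F(x,L)=\phi(Y(x))$ and $\Phi(x,L)=\phi(\Pi(x))$. Let $\beta(x)$ be the linear term in $L$ of $\Phi(x,L)$ (that is, the coefficient of $L^1$) and $\gamma(x)$ the linear term in $L$ of $F(x,L)$ (the coefficient of $L^1$). Suppose $\phi$ is a bialgebra morphism when restricted to the subalgebra $\mathsf{FdB}$. Then $\phi$ is a bialgebra morphism on all of $\mathsf{Rio}$ if and only if $F(x,L)$ satisfies the renormalization group equation $$\Big(\frac{\partial}{\partial L}-\beta(x)\frac{\partial}{\partial x}-\gamma(x)\Big)F(x,L)=0.$$
   Context: **Riordan Hopf algebra.** $\mathsf{Rio}=\mathbb K[\pi_1,\pi_2,\dots,y_1,y_2,\dots]$ as an algebra; put $\pi_0=y_0=1$, $\Pi(x)=x+\sum_{n\ge1}\pi_nx^{n+1}$, $Y(x)=1+\sum_{n\ge1}y_nx^n$. The coproduct is the algebra morphism with $\Delta\pi_n=\sum_{k=0}^n[x^{n+1}]\Pi(x)^{k+1}\otimes\pi_k$ and $\Delta y_n=\sum_{j=0}^n[x^n]Y(x)\Pi(x)^j\otimes y_j$; the counit kills all $\pi_n,y_n$ with $n\ge1$. $\mathsf{FdB}=\mathbb K[\pi_1,\pi_2,\dots]\subset\mathsf{Rio}$ is the Faà di Bruno sub-bialgebra. $\mathbb K[L]$ is the bialgebra with $\Delta L=L\otimes1+1\otimes L$, $\epsilon(L)=0$. Maps are applied to power series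 in $x$ coefficientwise, so $\phi(Y(x))=1+\sum_{n\ge1}\phi(y_n)x^n\in\mathbb K[L][[x]]$, and similarly for $\Pi$.
   Formalization: The condition F(x,0)=1 is added next to the renormalization group equation: φ is a bialgebra morphism iff F(x,0)=1 and the equation holds. Without it the claim fails, e.g. for φ(y_1)=1 and all other generators sent to 0. *)

theory Defs
  imports
    "HOL-Library.Poly_Mapping"
    "HOL-Library.Product_Plus"
    "HOL-Computational_Algebra.Polynomial"
    "HOL-Computational_Algebra.Formal_Power_Series"
begin

section \<open>Algebra morphisms\<close>

text \<open>
  \<open>sA\<close> and \<open>sB\<close> are the scalar multiplications by the ground field; \<open>S\<close> is a subalgebra
  of the source (\<open>UNIV\<close> for the full algebra).
\<close>

definition algebra_morphism_on ::
  "('k \<Rightarrow> 'a::comm_ring_1 \<Rightarrow> 'a) \<Rightarrow> ('k \<Rightarrow> 'b::comm_ring_1 \<Rightarrow> 'b) \<Rightarrow> 'a set \<Rightarrow> ('a \<Rightarrow> 'b) \<Rightarrow> bool"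
  where
  "algebra_morphism_on sA sB S f \<longleftrightarrow>
     f 1 = 1 \<and>
     (\<forall>p\<in>S. \<forall>q\<in>S. f (p + q) = f p + f q) \<and>
     (\<forall>p\<in>S. \<forall>q\<in>S. f (p * q) = f p * f q) \<and>
     (\<forall>c. \<forall>p\<in>S. f (sA c p) = sB c (f p))"

section \<open>Monoid algebras and linear extension\<close>

text \<open>
  The type \<open>'m \<Rightarrow>\<^sub>0 'k\<close> with its convolution product is the monoid algebra of \<open>'m\<close> over \<open>'k\<close>;
  \<open>Poly_Mapping.single m c\<close> is \<open>c\<close> times the basis element \<open>m\<close>.
  In \<open>linear_extension\<close>, \<open>\<eta>\<close> is the unit map of the target algebra and \<open>g\<close> prescribes
  the images of the basis elements.
\<close>

definition pm_scale :: "'k::comm_ring_1 \<Rightarrow> ('m::comm_monoid_add \<Rightarrow>\<^sub>0 'k) \<Rightarrow> ('m \<Rightarrow>\<^sub>0 'k)" where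
  "pm_scale c p = Poly_Mapping.single 0 c * p"

definition linear_extension ::
  "('k::zero \<Rightarrow> 'b::comm_ring_1) \<Rightarrow> ('m \<Rightarrow> 'b) \<Rightarrow> ('m \<Rightarrow>\<^sub>0 'k) \<Rightarrow> 'b" where
  "linear_extension \<eta> g p = (\<Sum>m\<in>Poly_Mapping.keys p. \<eta> (Poly_Mapping.lookup p m) * g m)"

lemma linear_extension_superset:
  assumes "\<eta> 0 = 0" "finite A" "Poly_Mapping.keys p \<subseteq> A"
  shows "linear_extension \<eta> g p = (\<Sum>m\<in>A. \<eta> (Poly_Mapping.lookup p m) * g m)"
  unfolding linear_extension_def using assms
  by (intro sum.mono_neutral_left) (auto simp: in_keys_iff)

lemma linear_extension_add:
  assumes "\<eta> 0 = 0" "\<And>a b. \<eta> (a + b) = \<eta> a + \<eta> b"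
  shows "linear_extension \<eta> g (p + q) = linear_extension \<eta> g p + linear_extension \<eta> g q"
proof -
  let ?A = "Poly_Mapping.keys p \<union> Poly_Mapping.keys q"
  have "Poly_Mapping.keys (p + q) \<subseteq> ?A" by (rule keys_add)
  then show ?thesis
    using assms
    by (simp add: linear_extension_superset[where A = ?A] lookup_add sum.distrib distrib_right)
qed

lemma linear_extension_single:
  "\<eta> 0 = 0 \<Longrightarrow> linear_extension \<eta> g (Poly_Mapping.single m c) = \<eta> c * g m"
  by (subst linear_extension_superset[where A = "{m}"]) auto

lemma pm_induct [case_names single add]:
  fixes p :: "'m \<Rightarrow>\<^sub>0 'k::comm_monoid_add"
  assumes "\<And>m c. P (Poly_Mapping.single m c)" "\<And>p q. P p \<Longrightarrow> P q \<Longrightarrow> P (p + q)"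
  shows "P p"
proof (induction p rule: update_induct)
  case const
  show ?case using assms(1)[of undefined 0] by simp
next
  case (update f a b)
  then have "Poly_Mapping.update a b f = f + Poly_Mapping.single a b"
    by (intro poly_mapping_eqI) (auto simp: lookup_update lookup_add lookup_single in_keys_iff when_def)
  then show ?case using assms update by simp
qed

lemma linear_extension_mult:
  assumes "\<eta> 0 = 0" "\<And>a b. \<eta> (a + b) = \<eta> a + \<eta> b" "\<And>a b. \<eta> (a * b) = \<eta> a * \<eta> b"
    and "\<And>m n. g (m + n) = g m * g n"
  shows "linear_extension \<eta> g (p * q) = linear_extension \<eta> g p * linear_extension \<eta> g q"
proof (induction p rule: pm_induct)
  case (single m c)
  show ?case
  proof (induction q rule: pm_induct)
    case (single n d)
    show ?case using assms by (simp add: linear_extension_single mult_single mult_ac)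
  next
    case (add q r)
    then show ?case using assms by (simp add: linear_extension_add distrib_left)
  qed
next
  case (add p r)
  then show ?case using assms by (simp add: linear_extension_add distrib_right)
qed

section \<open>The Riordan Hopf algebra\<close>

text \<open>
  The generator \<open>\<pi>\<^sub>n\<close> (\<open>n \<ge> 1\<close>) is \<open>PiGen (n - 1)\<close>, and \<open>y\<^sub>n\<close> is \<open>YGen (n - 1)\<close>, so that there are
  no generators of index \<open>0\<close>.
\<close>

datatype rio_gen = PiGen nat | YGen nat

type_synonym rio_mon = "rio_gen \<Rightarrow>\<^sub>0 nat"
type_synonym 'k rio = "rio_mon \<Rightarrow>\<^sub>0 'k"

text \<open>\<open>Rio \<otimes> Rio\<close>: the space with basis the pairs of monomials, multiplied componentwise.\<close>

type_synonym 'k rio_tensor = "rio_mon \<times> rio_mon \<Rightarrow>\<^sub>0 'k"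

definition rio_tens :: "'k::field rio \<Rightarrow> 'k rio \<Rightarrow> 'k rio_tensor" (infixr \<open>\<otimes>\<^sub>R\<close> 72) where
  "a \<otimes>\<^sub>R b = (\<Sum>m\<in>Poly_Mapping.keys a. \<Sum>n\<in>Poly_Mapping.keys b.
     Poly_Mapping.single (m, n) (Poly_Mapping.lookup a m * Poly_Mapping.lookup b n))"

lemma lookup_rio_tens:
  "Poly_Mapping.lookup (a \<otimes>\<^sub>R b) (m, n) = Poly_Mapping.lookup a m * Poly_Mapping.lookup b n"
proof -
  have "Poly_Mapping.lookup (a \<otimes>\<^sub>R b) (m, n) =
      (\<Sum>m'\<in>Poly_Mapping.keys a. \<Sum>n'\<in>Poly_Mapping.keys b.
        if m' = m \<and> n' = n then Poly_Mapping.lookup a m' * Poly_Mapping.lookup b n' else 0)"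
    by (simp add: rio_tens_def lookup_sum lookup_single when_def)
  also have "\<dots> = (\<Sum>m'\<in>Poly_Mapping.keys a. if m' = m then
      (\<Sum>n'\<in>Poly_Mapping.keys b. if n' = n then
         Poly_Mapping.lookup a m' * Poly_Mapping.lookup b n' else 0) else 0)"
    by (intro sum.cong) auto
  finally show ?thesis by (simp add: sum.delta in_keys_iff)
qed

lemma rio_tens_add_left: "(a + a') \<otimes>\<^sub>R b = a \<otimes>\<^sub>R b + a' \<otimes>\<^sub>R b"
  by (rule poly_mapping_eqI) (auto simp: lookup_rio_tens lookup_add distrib_right)

lemma rio_tens_add_right: "a \<otimes>\<^sub>R (b + b') = a \<otimes>\<^sub>R b + a \<otimes>\<^sub>R b'"
  by (rule poly_mapping_eqI) (auto simp: lookup_rio_tens lookup_add distrib_left)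

lemma rio_tens_single:
  "Poly_Mapping.single m c \<otimes>\<^sub>R Poly_Mapping.single n d = Poly_Mapping.single (m, n) (c * d)"
  by (rule poly_mapping_eqI) (auto simp: lookup_rio_tens lookup_single when_def split: if_splits)

lemma rio_tens_one: "1 \<otimes>\<^sub>R 1 = 1"
  using rio_tens_single[of 0 1 0 1] by (simp flip: zero_prod_def)

lemma rio_tens_mult: "(a \<otimes>\<^sub>R b) * (a' \<otimes>\<^sub>R b') = (a * a') \<otimes>\<^sub>R (b * b')"
proof (induction a rule: pm_induct)
  case a: (single m c)
  show ?case
  proof (induction b rule: pm_induct)
    case b: (single n d)
    show ?case
    proof (induction a' rule: pm_induct)
      case a': (single m' c')
      show ?case
        by (induction b' rule: pm_induct)
          (simp_all add: rio_tens_single mult_single mult_ac rio_tens_add_right distrib_left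
            distrib_right)
    qed (simp add: rio_tens_add_left distrib_left)
  qed (simp add: rio_tens_add_right distrib_right)
qed (simp add: rio_tens_add_left distrib_right)

definition rio_eval :: "('k::field \<Rightarrow> 'b::comm_ring_1) \<Rightarrow> (rio_gen \<Rightarrow> 'b) \<Rightarrow> 'k rio \<Rightarrow> 'b" where
  "rio_eval \<eta> f = linear_extension \<eta>
     (\<lambda>m. \<Prod>v\<in>Poly_Mapping.keys m. f v ^ Poly_Mapping.lookup m v)"

definition rio_var :: "rio_gen \<Rightarrow> 'k::field rio" where
  "rio_var v = Poly_Mapping.single (Poly_Mapping.single v 1) 1"

definition rio_pi :: "nat \<Rightarrow> 'k::field rio" where
  "rio_pi n = (case n of 0 \<Rightarrow> 1 | Suc k \<Rightarrow> rio_var (PiGen k))"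

definition rio_y :: "nat \<Rightarrow> 'k::field rio" where
  "rio_y n = (case n of 0 \<Rightarrow> 1 | Suc k \<Rightarrow> rio_var (YGen k))"

definition rio_Pi :: "'k::field rio fps" where
  "rio_Pi = Abs_fps (\<lambda>i. case i of 0 \<Rightarrow> 0 | Suc n \<Rightarrow> rio_pi n)"

definition rio_Y :: "'k::field rio fps" where
  "rio_Y = Abs_fps rio_y"

definition rio_coprod_gen :: "rio_gen \<Rightarrow> 'k::field rio_tensor" where
  "rio_coprod_gen v = (case v of
      PiGen i \<Rightarrow> (let n = Suc i in \<Sum>k=0..n. fps_nth (rio_Pi ^ (k + 1)) (n + 1) \<otimes>\<^sub>R rio_pi k)
    | YGen i \<Rightarrow> (let n = Suc i in \<Sum>j=0..n. fps_nth (rio_Y * rio_Pi ^ j) n \<otimes>\<^sub>R rio_y j))"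

definition rio_coprod :: "'k::field rio \<Rightarrow> 'k rio_tensor" where
  "rio_coprod = rio_eval (Poly_Mapping.single 0) rio_coprod_gen"

definition rio_counit :: "'k::field rio \<Rightarrow> 'k" where
  "rio_counit = rio_eval (\<lambda>c. c) (\<lambda>v. 0)"

lemma rio_mon_eval_add:
  fixes f :: "rio_gen \<Rightarrow> 'b::comm_ring_1"
  shows "(\<Prod>v\<in>Poly_Mapping.keys (m + n). f v ^ Poly_Mapping.lookup (m + n) v) =
    (\<Prod>v\<in>Poly_Mapping.keys m. f v ^ Poly_Mapping.lookup m v) *
    (\<Prod>v\<in>Poly_Mapping.keys n. f v ^ Poly_Mapping.lookup n v)"
proof -
  let ?A = "Poly_Mapping.keys m \<union> Poly_Mapping.keys n"
  have ext: "(\<Prod>v\<in>Poly_Mapping.keys l. f v ^ Poly_Mapping.lookup l v) =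
      (\<Prod>v\<in>?A. f v ^ Poly_Mapping.lookup l v)" if "Poly_Mapping.keys l \<subseteq> ?A" for l
    using that by (intro prod.mono_neutral_left) (auto simp: in_keys_iff)
  show ?thesis
    unfolding ext[OF keys_add] ext[OF Un_upper1] ext[OF Un_upper2]
    by (simp add: lookup_add power_add prod.distrib)
qed

lemma rio_eval_var: "\<eta> 0 = 0 \<Longrightarrow> \<eta> 1 = 1 \<Longrightarrow> rio_eval \<eta> f (rio_var v) = f v"
  by (simp add: rio_eval_def rio_var_def linear_extension_single)

lemma algebra_morphism_rio_eval:
  assumes "\<eta> 0 = 0" "\<eta> 1 = 1" "\<And>a b. \<eta> (a + b) = \<eta> a + \<eta> b" "\<And>a b. \<eta> (a * b) = \<eta> a * \<eta> b"
  shows "algebra_morphism_on pm_scale (\<lambda>c. (*) (\<eta> c)) UNIV (rio_eval \<eta> f)"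
proof -
  have mult: "rio_eval \<eta> f (p * q) = rio_eval \<eta> f p * rio_eval \<eta> f q" for p q
    unfolding rio_eval_def using assms by (intro linear_extension_mult) (auto simp: rio_mon_eval_add)
  have const: "rio_eval \<eta> f (Poly_Mapping.single 0 c) = \<eta> c" for c
    using assms by (simp add: rio_eval_def linear_extension_single)
  show ?thesis
    using const[of 1] assms
    by (auto simp: algebra_morphism_on_def mult const pm_scale_def)
      (simp add: rio_eval_def linear_extension_add)
qed

lemma algebra_morphism_rio_coprod: "algebra_morphism_on pm_scale pm_scale UNIV rio_coprod"
proof -
  have "algebra_morphism_on pm_scale
      (\<lambda>c. (*) (Poly_Mapping.single (0 :: rio_mon \<times> rio_mon) (c :: 'a))) UNIV rio_coprod"
    unfolding rio_coprod_def
    by (rule algebra_morphism_rio_eval) (simp_all add: single_add mult_single)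
  then show ?thesis unfolding algebra_morphism_on_def pm_scale_def .
qed

lemma rio_coprod_pi:
  "rio_coprod (rio_pi n) = (\<Sum>k=0..n. fps_nth (rio_Pi ^ (k + 1)) (n + 1) \<otimes>\<^sub>R rio_pi k)"
proof (cases n)
  case 0
  then show ?thesis
    using algebra_morphism_rio_coprod[where 'a = 'a]
    by (simp add: algebra_morphism_on_def rio_pi_def rio_Pi_def rio_tens_one)
next
  case (Suc i)
  have "rio_coprod (rio_pi n :: 'a rio) = rio_coprod_gen (PiGen i)"
    by (simp add: Suc rio_pi_def rio_coprod_def rio_eval_var)
  then show ?thesis by (simp add: rio_coprod_gen_def Let_def Suc del: sum.atLeast0_atMost_Suc)
qed

lemma rio_coprod_y:
  "rio_coprod (rio_y n) = (\<Sum>j=0..n. fps_nth (rio_Y * rio_Pi ^ j) n \<otimes>\<^sub>R rio_y j)"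
proof (cases n)
  case 0
  then show ?thesis
    using algebra_morphism_rio_coprod[where 'a = 'a]
    by (simp add: algebra_morphism_on_def rio_y_def rio_Y_def rio_tens_one)
next
  case (Suc i)
  have "rio_coprod (rio_y n :: 'a rio) = rio_coprod_gen (YGen i)"
    by (simp add: Suc rio_y_def rio_coprod_def rio_eval_var)
  then show ?thesis by (simp add: rio_coprod_gen_def Let_def Suc del: sum.atLeast0_atMost_Suc)
qed

lemma algebra_morphism_rio_counit: "algebra_morphism_on pm_scale (*) UNIV rio_counit"
  unfolding rio_counit_def by (rule algebra_morphism_rio_eval) auto

lemma rio_counit_gen: "n \<ge> 1 \<Longrightarrow> rio_counit (rio_pi n) = 0" "n \<ge> 1 \<Longrightarrow> rio_counit (rio_y n) = 0"
  by (cases n; simp add: rio_counit_def rio_pi_def rio_y_def rio_eval_var)+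

text \<open>The polynomials in which only the \<open>\<pi>\<^sub>n\<close> occur.\<close>

definition FdB :: "'k::field rio set" where
  "FdB = {p. \<forall>m\<in>Poly_Mapping.keys p. Poly_Mapping.keys m \<subseteq> range PiGen}"

section \<open>The bialgebra of polynomials in one primitive variable\<close>

text \<open>
  \<open>\<bbbK>[L]\<close> is \<open>'k poly\<close> and \<open>\<bbbK>[L] \<otimes> \<bbbK>[L]\<close> is \<open>'k poly poly\<close>: the coefficient of
  \<open>L\<^sup>i \<otimes> L\<^sup>j\<close> in \<open>t\<close> is \<open>coeff (coeff t i) j\<close>.
\<close>

definition poly_tens :: "'k::field poly \<Rightarrow> 'k poly \<Rightarrow> 'k poly poly" (infixr \<open>\<otimes>\<^sub>L\<close> 72) where
  "a \<otimes>\<^sub>L b = map_poly (\<lambda>c. smult c b) a"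

lemma coeff_poly_tens: "coeff (coeff (a \<otimes>\<^sub>L b) i) j = coeff a i * coeff b j"
  by (simp add: poly_tens_def coeff_map_poly)

lemma poly_tens_mult: "(a \<otimes>\<^sub>L b) * (a' \<otimes>\<^sub>L b') = (a * a') \<otimes>\<^sub>L (b * b')"
proof (rule poly_eqI)
  fix i
  show "coeff ((a \<otimes>\<^sub>L b) * (a' \<otimes>\<^sub>L b')) i = coeff ((a * a') \<otimes>\<^sub>L (b * b')) i"
    by (simp add: coeff_mult poly_tens_def coeff_map_poly smult_sum mult.commute)
qed

definition poly_coprod :: "'k::field poly \<Rightarrow> 'k poly poly" where
  "poly_coprod p = poly (map_poly (\<lambda>c. [:[:c:]:]) p) ([:0, 1:] \<otimes>\<^sub>L 1 + 1 \<otimes>\<^sub>L [:0, 1:])"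

definition poly_counit :: "'k::field poly \<Rightarrow> 'k" where
  "poly_counit p = poly p 0"

section \<open>Bialgebra morphisms\<close>

text \<open>\<open>\<phi> \<otimes> \<phi>\<close>, by linear extension from the basis of pairs of monomials.\<close>

definition tens_map :: "('k::field rio \<Rightarrow> 'k poly) \<Rightarrow> 'k rio_tensor \<Rightarrow> 'k poly poly" where
  "tens_map \<phi> = linear_extension (\<lambda>c. [:[:c:]:])
     (\<lambda>(m, n). \<phi> (Poly_Mapping.single m 1) \<otimes>\<^sub>L \<phi> (Poly_Mapping.single n 1))"

definition rio_algebra_morphism_on :: "'k::field rio set \<Rightarrow> ('k rio \<Rightarrow> 'k poly) \<Rightarrow> bool" where
  "rio_algebra_morphism_on S \<phi> \<longleftrightarrow> algebra_morphism_on pm_scale smult S \<phi>"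

definition rio_bialgebra_morphism_on :: "'k::field rio set \<Rightarrow> ('k rio \<Rightarrow> 'k poly) \<Rightarrow> bool" where
  "rio_bialgebra_morphism_on S \<phi> \<longleftrightarrow>
     rio_algebra_morphism_on S \<phi> \<and>
     (\<forall>p\<in>S. poly_coprod (\<phi> p) = tens_map \<phi> (rio_coprod p)) \<and>
     (\<forall>p\<in>S. poly_counit (\<phi> p) = rio_counit p)"

lemma tens_map_tens:
  assumes "rio_algebra_morphism_on UNIV \<phi>"
  shows "tens_map \<phi> (a \<otimes>\<^sub>R b) = \<phi> a \<otimes>\<^sub>L \<phi> b"
proof -
  have add: "\<phi> (p + q) = \<phi> p + \<phi> q" for p q
    using assms by (simp add: rio_algebra_morphism_on_def algebra_morphism_on_def)
  have scale: "\<phi> (Poly_Mapping.single m c) = smult c (\<phi> (Poly_Mapping.single m 1))" for m c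
  proof -
    have "Poly_Mapping.single m c = pm_scale c (Poly_Mapping.single m 1)"
      by (simp add: pm_scale_def mult_single)
    then show ?thesis
      using assms by (simp add: rio_algebra_morphism_on_def algebra_morphism_on_def)
  qed
  have tadd: "tens_map \<phi> (s + t) = tens_map \<phi> s + tens_map \<phi> t" for s t
    unfolding tens_map_def by (rule linear_extension_add) auto
  have padd1: "(p + q) \<otimes>\<^sub>L r = p \<otimes>\<^sub>L r + q \<otimes>\<^sub>L r" for p q r :: "'a poly"
    by (intro poly_eqI) (simp add: coeff_poly_tens distrib_right)
  have padd2: "r \<otimes>\<^sub>L (p + q) = r \<otimes>\<^sub>L p + r \<otimes>\<^sub>L q" for p q r :: "'a poly"
    by (intro poly_eqI) (simp add: coeff_poly_tens distrib_left)
  show ?thesis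
  proof (induction a rule: pm_induct)
    case (single m c)
    show ?case
    proof (induction b rule: pm_induct)
      case (single n d)
      have "tens_map \<phi> (Poly_Mapping.single (m, n) (c * d)) =
          [:[:c * d:]:] * (\<phi> (Poly_Mapping.single m 1) \<otimes>\<^sub>L \<phi> (Poly_Mapping.single n 1))"
        by (simp add: tens_map_def linear_extension_single)
      also have "\<dots> = \<phi> (Poly_Mapping.single m c) \<otimes>\<^sub>L \<phi> (Poly_Mapping.single n d)"
        unfolding scale[of m c] scale[of n d]
        by (intro poly_eqI) (simp add: coeff_poly_tens)
      finally show ?case by (simp add: rio_tens_single)
    qed (simp add: rio_tens_add_right tadd add padd2)
  qed (simp add: rio_tens_add_left tadd add padd1)
qed

section \<open>Power series over \<open>\<bbbK>[L]\<close>\<close>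

definition fps_map_coeffs :: "('a \<Rightarrow> 'b) \<Rightarrow> 'a fps \<Rightarrow> 'b fps" where
  "fps_map_coeffs f A = Abs_fps (\<lambda>n. f (fps_nth A n))"

definition fps_L_coeff :: "nat \<Rightarrow> 'k::field poly fps \<Rightarrow> 'k fps" where
  "fps_L_coeff i = fps_map_coeffs (\<lambda>p. coeff p i)"

text \<open>The inclusion of \<open>\<bbbK>[[x]]\<close> in \<open>\<bbbK>[L][[x]]\<close>.\<close>

definition fps_const_L :: "'k::field fps \<Rightarrow> 'k poly fps" where
  "fps_const_L = fps_map_coeffs (\<lambda>c. [:c:])"

definition fps_deriv_L :: "'k::field poly fps \<Rightarrow> 'k poly fps" where
  "fps_deriv_L = fps_map_coeffs pderiv"

text \<open>
  The normalization \<open>F(x, 0) = 1\<close>. The equation \<open>RGE\<close> below does not imply it: if \<open>\<phi>\<close> sends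
  \<open>y\<^sub>1\<close> to \<open>1\<close> and all other generators to \<open>0\<close>, then \<open>\<beta> = \<gamma> = 0\<close> and \<open>F = 1 + x\<close> solves \<open>RGE\<close>,
  but \<open>\<phi>\<close> does not respect the counit at \<open>y\<^sub>1\<close>, although it is a bialgebra morphism on \<open>FdB\<close>.
\<close>

definition initial_condition :: "'k::field poly fps \<Rightarrow> bool" where
  "initial_condition F \<longleftrightarrow> fps_L_coeff 0 F = 1"

definition RGE :: "'k::field fps \<Rightarrow> 'k fps \<Rightarrow> 'k poly fps \<Rightarrow> bool" where
  "RGE \<beta> \<gamma> F \<longleftrightarrow>
     fps_deriv_L F - fps_const_L \<beta> * fps_deriv F - fps_const_L \<gamma> * F = 0"

end

theory Submission
  imports Defs
begin

text \<open>
  Since all maps involved are algebra morphisms, \<open>\<phi>\<close> is a bialgebra morphism iff it respects the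
  counit and coproduct on each \<open>y\<^sub>n\<close>, that is, iff \<open>F(x, 0) = 1\<close> and
  \<open>F(x, L\<^sub>1 + L\<^sub>2) = F(x, L\<^sub>1) F(\<Phi>(x, L\<^sub>1), L\<^sub>2)\<close>. Put \<open>D h = \<beta> h' + \<gamma> h\<close> on \<open>\<bbbK>[[x]]\<close>, so that RGE
  says that the coefficients \<open>f\<^sub>k\<close> of \<open>L\<^sup>k\<close> in \<open>F\<close> satisfy \<open>(k + 1) f\<^sub>k\<^sub>+\<^sub>1 = D f\<^sub>k\<close>. The part of the
  coproduct identity that is linear in \<open>L\<^sub>1\<close> is exactly RGE. In the same way, the identity
  \<open>\<Phi>(x, L\<^sub>1 + L\<^sub>2) = \<Phi>(\<Phi>(x, L\<^sub>1), L\<^sub>2)\<close> on \<open>FdB\<close> shows that \<open>\<Phi>\<close> is annihilated by the derivation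
  \<open>\<partial>\<^sub>L - \<beta> \<partial>\<^sub>x\<close>. Conversely, RGE for \<open>F\<close> therefore implies RGE for every \<open>F \<Phi>\<^sup>j\<close>, whose value at
  \<open>L = 0\<close> is \<open>x\<^sup>j\<close>; hence its coefficient of \<open>L\<^sup>i\<close> is \<open>D\<^sup>i x\<^sup>j / i!\<close>, and by linearity the coefficient
  of \<open>L\<^sub>1\<^sup>i L\<^sub>2\<^sup>k\<close> on the right-hand side is \<open>D\<^sup>i f\<^sub>k / i! = D\<^sup>i\<^sup>+\<^sup>k 1 / (i! k!)\<close>, as on the left.
\<close>

section \<open>Coefficients in \<open>L\<close>\<close>

lemma fps_L_coeff_nth [simp]: "fps_nth (fps_L_coeff i A) n = coeff (fps_nth A n) i"
  by (simp add: fps_L_coeff_def fps_map_coeffs_def)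

lemma fps_const_L_nth [simp]: "fps_nth (fps_const_L b) n = [:fps_nth b n:]"
  by (simp add: fps_const_L_def fps_map_coeffs_def)

lemma fps_deriv_L_nth [simp]: "fps_nth (fps_deriv_L A) n = pderiv (fps_nth A n)"
  by (simp add: fps_deriv_L_def fps_map_coeffs_def)

lemma fps_eq_iff_L_coeff: "A = B \<longleftrightarrow> (\<forall>i. fps_L_coeff i A = fps_L_coeff i B)"
  by (auto simp: fps_eq_iff poly_eq_iff)

lemma fps_L_coeff_add: "fps_L_coeff i (A + B) = fps_L_coeff i A + fps_L_coeff i B"
  by (simp add: fps_eq_iff)

lemma fps_L_coeff_const_L_mult: "fps_L_coeff i (fps_const_L b * A) = b * fps_L_coeff i A"
  by (simp add: fps_eq_iff fps_mult_nth coeff_sum)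

lemma fps_L_coeff_fps_deriv: "fps_L_coeff i (fps_deriv A) = fps_deriv (fps_L_coeff i A)"
  by (simp add: fps_eq_iff of_nat_poly del: of_nat_Suc)

lemma fps_L_coeff_deriv_L:
  "fps_L_coeff i (fps_deriv_L A) = of_nat (Suc i) * fps_L_coeff (Suc i) A"
  by (simp add: fps_eq_iff coeff_pderiv fps_mult_of_nat_nth del: of_nat_Suc)

lemma fps_L_coeff_0_mult: "fps_L_coeff 0 (A * B) = fps_L_coeff 0 A * fps_L_coeff 0 B"
  by (simp add: fps_eq_iff fps_mult_nth coeff_sum coeff_mult_0)

lemma fps_L_coeff_0_one: "fps_L_coeff 0 1 = 1"
  by (simp add: fps_eq_iff)

lemma fps_L_coeff_0_power: "fps_L_coeff 0 (A ^ n) = fps_L_coeff 0 A ^ n"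
  by (induction n) (simp_all add: fps_L_coeff_0_mult fps_L_coeff_0_one)

text \<open>Modulo L^2, taking the coefficient of L is a derivation over taking the value at L =
  0.\<close>

lemma fps_L_coeff_1_mult:
  "fps_L_coeff (Suc 0) (A * B) =
    fps_L_coeff (Suc 0) A * fps_L_coeff 0 B + fps_L_coeff 0 A * fps_L_coeff (Suc 0) B"
  by (simp add: fps_eq_iff fps_mult_nth coeff_sum coeff_mult sum.distrib add.commute)

lemma fps_L_coeff_1_power:
  "fps_L_coeff (Suc 0) (A ^ Suc n) =
    of_nat (Suc n) * fps_L_coeff 0 A ^ n * fps_L_coeff (Suc 0) A"
proof (induction n)
  case (Suc n)
  show ?case
    unfolding power_Suc[of A "Suc n"] fps_L_coeff_1_mult Suc
    by (simp add: fps_L_coeff_0_mult fps_L_coeff_0_power algebra_simps)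
qed simp

lemma fps_deriv_L_mult: "fps_deriv_L (A * B) = fps_deriv_L A * B + A * fps_deriv_L B"
proof -
  have "pderiv (\<Sum>i\<in>S. f i * g i) = (\<Sum>i\<in>S. pderiv (f i) * g i) + (\<Sum>i\<in>S. f i * pderiv (g i))"
    for S :: "nat set" and f g :: "nat \<Rightarrow> 'a poly"
    by (induction S rule: infinite_finite_induct)
      (simp_all add: pderiv_add pderiv_mult algebra_simps)
  then show ?thesis
    by (simp add: fps_eq_iff fps_mult_nth)
qed

section \<open>The renormalization group operator\<close>

text \<open>The operator D of the overview; for \<gamma> = 0 it is a derivation.\<close>

definition rge_op :: "'k::field fps \<Rightarrow> 'k fps \<Rightarrow> 'k fps \<Rightarrow> 'k fps" where
  "rge_op \<beta> \<gamma> h = \<beta> * fps_deriv h + \<gamma> * h"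

lemma RGE_iff_fps_deriv_L:
  "RGE \<beta> \<gamma> A \<longleftrightarrow> fps_deriv_L A = fps_const_L \<beta> * fps_deriv A + fps_const_L \<gamma> * A"
  by (auto simp: RGE_def algebra_simps)

lemma RGE_iff:
  "RGE \<beta> \<gamma> A \<longleftrightarrow> (\<forall>k. of_nat (Suc k) * fps_L_coeff (Suc k) A = rge_op \<beta> \<gamma> (fps_L_coeff k A))"
  unfolding RGE_iff_fps_deriv_L fps_eq_iff_L_coeff
  by (simp add: fps_L_coeff_deriv_L fps_L_coeff_add fps_L_coeff_const_L_mult fps_L_coeff_fps_deriv
      rge_op_def del: of_nat_Suc)

text \<open>The derivation d/dL - \<beta> d/dx annihilates B, hence every B^j, so in the product it
  acts on the factor A alone.\<close>

lemma RGE_mult_power: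
  assumes "RGE \<beta> \<gamma> A" "RGE \<beta> 0 B"
  shows "RGE \<beta> \<gamma> (A * B ^ j)"
proof (induction j)
  case (Suc j)
  have [simp]: "fps_const_L 0 = (0 :: 'a poly fps)"
    by (simp add: fps_eq_iff)
  have "fps_deriv_L (A * B ^ Suc j) = fps_deriv_L ((A * B ^ j) * B)"
    by (simp add: algebra_simps)
  also have "\<dots> = (fps_const_L \<beta> * fps_deriv (A * B ^ j) + fps_const_L \<gamma> * (A * B ^ j)) * B
      + (A * B ^ j) * (fps_const_L \<beta> * fps_deriv B)"
    using Suc assms(2) unfolding RGE_iff_fps_deriv_L fps_deriv_L_mult[of "A * B ^ j"] by simp
  also have "\<dots> = fps_const_L \<beta> * fps_deriv ((A * B ^ j) * B) + fps_const_L \<gamma> * ((A * B ^ j) * B)"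
    unfolding fps_deriv_mult[of "A * B ^ j" B] by (simp only: algebra_simps)
  finally show ?case
    unfolding RGE_iff_fps_deriv_L by (simp add: algebra_simps)
qed (use assms in simp)

lemma rge_op_add: "rge_op \<beta> \<gamma> (g + h) = rge_op \<beta> \<gamma> g + rge_op \<beta> \<gamma> h"
  by (simp add: rge_op_def algebra_simps)

lemma rge_op_const_mult: "rge_op \<beta> \<gamma> (fps_const c * h) = fps_const c * rge_op \<beta> \<gamma> h"
  by (simp add: rge_op_def algebra_simps)

lemma rge_op_zero: "rge_op \<beta> \<gamma> 0 = 0"
  by (simp add: rge_op_def)

lemma rge_op_pow_const_mult:
  "(rge_op \<beta> \<gamma> ^^ i) (fps_const c * h) = fps_const c * (rge_op \<beta> \<gamma> ^^ i) h"
  by (induction i) (simp_all add: rge_op_const_mult)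

lemma rge_op_pow_sum:
  "(rge_op \<beta> \<gamma> ^^ i) (\<Sum>j\<in>S. h j) = (\<Sum>j\<in>S. (rge_op \<beta> \<gamma> ^^ i) (h j))"
proof -
  have add: "(rge_op \<beta> \<gamma> ^^ i) (g + h) = (rge_op \<beta> \<gamma> ^^ i) g + (rge_op \<beta> \<gamma> ^^ i) h" for g h
    by (induction i) (simp_all add: rge_op_add)
  have "(rge_op \<beta> \<gamma> ^^ i) 0 = 0"
    by (induction i) (simp_all add: rge_op_zero)
  then show ?thesis
    by (induction S rule: infinite_finite_induct) (simp_all add: add)
qed

text \<open>Differentiation lowers degrees by one, and multiplication by \<beta>, which has no
  constant term, raises them again.\<close>

lemma rge_op_cong_nth:
  assumes "fps_nth \<beta> 0 = 0" "\<And>j. j \<le> n \<Longrightarrow> fps_nth g j = fps_nth h j" "m \<le> n"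
  shows "fps_nth (rge_op \<beta> \<gamma> g) m = fps_nth (rge_op \<beta> \<gamma> h) m"
proof -
  have "fps_nth \<beta> i * fps_nth (fps_deriv g) (m - i) = fps_nth \<beta> i * fps_nth (fps_deriv h) (m - i)"
    if "i \<in> {0..m}" for i
    \<comment> \<open>For i = 0 the coefficient of degree m + 1 enters, possibly beyond n, but its
      factor \<open>fps_nth \<beta> 0\<close> is zero.\<close>
    using that assms by (cases i) (auto simp: Suc_diff_Suc)
  then show ?thesis
    using assms unfolding rge_op_def fps_add_nth fps_mult_nth
    by (intro arg_cong2[of _ _ _ _ "(+)"] sum.cong) auto
qed

text \<open>The matrix of D^i on the powers of x: by linearity and the previous lemma, g may be
  truncated at degree n. The coproducts produce sums over j of this shape.\<close>

lemma rge_op_pow_nth: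
  assumes "fps_nth \<beta> 0 = 0"
  shows "fps_nth ((rge_op \<beta> \<gamma> ^^ i) g) n =
    (\<Sum>j=0..n. fps_nth ((rge_op \<beta> \<gamma> ^^ i) (fps_X ^ j)) n * fps_nth g j)"
proof -
  define h where "h = (\<Sum>j=0..n. fps_const (fps_nth g j) * fps_X ^ j)"
  have h: "fps_nth g j = fps_nth h j" if "j \<le> n" for j
    using that by (simp add: h_def fps_sum_nth if_distrib[of "(*) _"] cong: if_cong)
  have "\<forall>m\<le>n. fps_nth ((rge_op \<beta> \<gamma> ^^ i) g) m = fps_nth ((rge_op \<beta> \<gamma> ^^ i) h) m"
  proof (induction i)
    case (Suc i)
    then show ?case
      unfolding funpow.simps comp_apply by (intro allI impI rge_op_cong_nth[OF assms]) auto
  qed (use h in auto)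
  then have "fps_nth ((rge_op \<beta> \<gamma> ^^ i) g) n = fps_nth ((rge_op \<beta> \<gamma> ^^ i) h) n"
    by simp
  then show ?thesis
    by (simp add: h_def rge_op_pow_sum rge_op_pow_const_mult fps_sum_nth
        mult.commute[of "fps_nth g _"])
qed

text \<open>Iterating the recursion from index k collects the factors (k + 1) ... (k + i); for k = 0
  they give i!.\<close>

lemma RGE_L_coeff_add:
  assumes "RGE \<beta> \<gamma> A"
  shows "(rge_op \<beta> \<gamma> ^^ i) (fps_L_coeff k A) =
    fps_const (pochhammer (of_nat (Suc k)) i) * fps_L_coeff (i + k) A"
proof (induction i)
  case (Suc i)
  have "rge_op \<beta> \<gamma> (fps_L_coeff (i + k) A) =
      fps_const (of_nat (Suc k) + of_nat i) * fps_L_coeff (Suc (i + k)) A"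
    using assms[unfolded RGE_iff, rule_format, of "i + k"]
    by (simp add: fps_of_nat[symmetric] algebra_simps)
  then show ?case
    by (simp add: Suc rge_op_const_mult pochhammer_Suc flip: fps_const_mult mult.assoc)
qed simp

lemma rge_op_nth:
  assumes "fps_nth \<beta> 0 = 0"
  shows "fps_nth (rge_op \<beta> \<gamma> g) n =
    (\<Sum>j=0..n. fps_nth (rge_op \<beta> \<gamma> (fps_X ^ j)) n * fps_nth g j)"
  using rge_op_pow_nth[OF assms, where i = "Suc 0"] unfolding funpow.simps comp_id .

section \<open>Generators\<close>

text \<open>The target and its scalar action stay arbitrary, since coproducts are compared in
  \<open>'k poly poly\<close> and counits in \<open>'k\<close>.\<close>

lemma algebra_morphism_on_UNIV_ext:
  fixes f g :: "'k::field rio \<Rightarrow> 'b::comm_ring_1"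
  assumes f: "algebra_morphism_on pm_scale s UNIV f" and g: "algebra_morphism_on pm_scale s UNIV g"
    and pi: "\<And>n. f (rio_pi n) = g (rio_pi n)" and y: "\<And>n. f (rio_y n) = g (rio_y n)"
  shows "f = g"
proof
  fix p
  note f = f[unfolded algebra_morphism_on_def, simplified]
  note g = g[unfolded algebra_morphism_on_def, simplified]
  have var: "f (rio_var v) = g (rio_var v)" for v
  proof (cases v)
    case (PiGen i)
    then show ?thesis using pi[of "Suc i"] by (simp add: rio_pi_def)
  next
    case (YGen i)
    then show ?thesis using y[of "Suc i"] by (simp add: rio_y_def)
  qed
  have mon: "f (Poly_Mapping.single m 1) = g (Poly_Mapping.single m 1)" for m
  proof (induction m rule: pm_induct)
    case (single v k)
    show ?case
    proof (induction k)
      case 0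
      then show ?case using f g by simp
    next
      case (Suc k)
      have "Poly_Mapping.single (Poly_Mapping.single v (Suc k)) (1::'k) =
          rio_var v * Poly_Mapping.single (Poly_Mapping.single v k) 1"
        by (simp add: rio_var_def mult_single flip: single_add)
      then show ?case using f g Suc var by simp
    qed
  next
    case (add m n)
    have "Poly_Mapping.single (m + n) (1::'k) =
        Poly_Mapping.single m 1 * Poly_Mapping.single n 1"
      by (simp add: mult_single)
    then show ?case using f g add by simp
  qed
  show "f p = g p"
  proof (induction p rule: pm_induct)
    case (single m c)
    have "Poly_Mapping.single m c = pm_scale c (Poly_Mapping.single m 1)"
      by (simp add: pm_scale_def mult_single)
    then show ?case using f g mon by simp
  qed (use f g in simp)
qed

lemma rio_pi_in_FdB: "rio_pi n \<in> FdB"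
  by (auto simp: rio_pi_def rio_var_def FdB_def split: nat.splits)

section \<open>The coproducts\<close>

text \<open>A Horner step: \<open>[:[:0, 1:], 1:]\<close> is \<Delta>L, the outer variable standing
  for the left tensor factor.\<close>

lemma poly_coprod_pCons:
  "poly_coprod (pCons a p) = [:[:a:]:] + [:[:0, 1:], 1:] * poly_coprod p"
proof -
  have "[:0, 1:] \<otimes>\<^sub>L 1 + 1 \<otimes>\<^sub>L [:0, 1:] = [:[:0, 1:], 1 :: 'a poly:]"
    by (intro poly_eqI) (simp add: coeff_poly_tens coeff_pCons split: nat.splits)
  then show ?thesis
    by (cases "p = 0 \<and> a = 0") (auto simp: poly_coprod_def map_poly_pCons)
qed

lemma poly_coprod_0: "poly_coprod 0 = 0"
  by (simp add: poly_coprod_def)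

lemma poly_coprod_add: "poly_coprod (p + q) = poly_coprod p + poly_coprod q"
proof (induction p arbitrary: q)
  case (pCons a p)
  obtain b r where q: "q = pCons b r" by (cases q)
  have "poly_coprod (pCons a p + q) =
      ([:[:a:]:] + [:[:b:]:]) + [:[:0, 1:], 1:] * (poly_coprod p + poly_coprod r)"
    by (simp only: q add_pCons poly_coprod_pCons pCons) simp
  then show ?case
    by (simp only: q poly_coprod_pCons algebra_simps)
qed (simp add: poly_coprod_0)

lemma poly_coprod_smult: "poly_coprod (smult c p) = [:[:c:]:] * poly_coprod p"
  by (induction p) (simp_all add: poly_coprod_0 poly_coprod_pCons algebra_simps smult_add_right)

lemma poly_coprod_mult: "poly_coprod (p * q) = poly_coprod p * poly_coprod q"
proof (induction p)
  case (pCons a p)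
  then show ?case
    by (simp add: poly_coprod_add poly_coprod_pCons poly_coprod_smult algebra_simps smult_add_right)
qed (simp add: poly_coprod_0)

lemma poly_coprod_1: "poly_coprod 1 = 1"
  by (simp add: one_pCons poly_coprod_pCons poly_coprod_0)

text \<open>Binomial expansion of the powers of \<Delta>L; the induction step is Pascal's
  rule.\<close>

lemma coeff_poly_coprod:
  "coeff (coeff (poly_coprod p) i) k = of_nat ((i + k) choose i) * coeff p (i + k)"
proof (induction p arbitrary: i k)
  case (pCons a p)
  show ?case
    by (cases i; cases k)
      (simp_all add: poly_coprod_pCons pCons coeff_pCons algebra_simps split: nat.splits)
qed (simp add: poly_coprod_0)

section \<open>The tensor square of \<phi> and reduction to generators\<close>

lemma tens_map_add: "tens_map \<phi> (s + t) = tens_map \<phi> s + tens_map \<phi> t"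
  unfolding tens_map_def by (rule linear_extension_add) auto

lemma tens_map_sum: "tens_map \<phi> (\<Sum>i\<in>S. t i) = (\<Sum>i\<in>S. tens_map \<phi> (t i))"
proof -
  have "tens_map \<phi> 0 = 0" by (simp add: tens_map_def linear_extension_def)
  then show ?thesis
    by (induction S rule: infinite_finite_induct) (simp_all add: tens_map_add)
qed

lemma tens_map_mult:
  assumes "rio_algebra_morphism_on UNIV \<phi>"
  shows "tens_map \<phi> (s * t) = tens_map \<phi> s * tens_map \<phi> t"
proof -
  have "\<phi> (Poly_Mapping.single (m + n) 1) =
      \<phi> (Poly_Mapping.single m 1) * \<phi> (Poly_Mapping.single n 1)" for m n
    using assms unfolding rio_algebra_morphism_on_def algebra_morphism_on_def
    by (metis UNIV_I mult_1 mult_single)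
  then show ?thesis
    unfolding tens_map_def by (intro linear_extension_mult) (auto simp: poly_tens_mult)
qed

lemma algebra_morphism_tens_map_coprod:
  assumes "rio_algebra_morphism_on UNIV \<phi>"
  shows "algebra_morphism_on pm_scale (\<lambda>c. (*) [:[:c:]:]) UNIV (\<lambda>p. tens_map \<phi> (rio_coprod p))"
proof -
  note coprod =
    algebra_morphism_rio_coprod[where 'a = 'a, unfolded algebra_morphism_on_def, simplified]
  have one: "\<phi> 1 = 1"
    using assms by (simp add: rio_algebra_morphism_on_def algebra_morphism_on_def)
  have "tens_map \<phi> (Poly_Mapping.single 0 c) = [:[:c:]:]" for c
  proof -
    have "1 \<otimes>\<^sub>L 1 = (1 :: 'a poly poly)"
      by (intro poly_eqI) (simp add: coeff_poly_tens)
    then show ?thesis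
      using one by (simp add: tens_map_def linear_extension_single zero_prod_def)
  qed
  moreover from this[of 1] have "tens_map \<phi> 1 = 1"
    by (simp add: one_pCons)
  ultimately have "tens_map \<phi> 1 = 1" "tens_map \<phi> (pm_scale c t) = [:[:c:]:] * tens_map \<phi> t" for c t
    by (simp_all add: pm_scale_def tens_map_mult[OF assms])
  then show ?thesis
    using coprod
    by (simp add: algebra_morphism_on_def tens_map_add tens_map_mult[OF assms])
qed

lemma algebra_morphism_poly_coprod:
  assumes "rio_algebra_morphism_on UNIV \<phi>"
  shows "algebra_morphism_on pm_scale (\<lambda>c. (*) [:[:c:]:]) UNIV (\<lambda>p. poly_coprod (\<phi> p))"
  using assms
  by (simp add: rio_algebra_morphism_on_def algebra_morphism_on_def poly_coprod_1 poly_coprod_add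
      poly_coprod_mult poly_coprod_smult)

lemma algebra_morphism_poly_counit:
  assumes "rio_algebra_morphism_on UNIV \<phi>"
  shows "algebra_morphism_on pm_scale (*) UNIV (\<lambda>p. poly_counit (\<phi> p))"
  using assms
  by (simp add: rio_algebra_morphism_on_def algebra_morphism_on_def poly_counit_def)

text \<open>Both sides of each identity are algebra morphisms, and the hypothesis on
  \<open>FdB\<close> settles the generators \<pi>, so only the y remain.\<close>

lemma rio_bialgebra_morphism_on_UNIV_iff:
  assumes "rio_algebra_morphism_on UNIV \<phi>" "rio_bialgebra_morphism_on FdB \<phi>"
  shows "rio_bialgebra_morphism_on UNIV \<phi> \<longleftrightarrow>
    (\<forall>n. poly_coprod (\<phi> (rio_y n)) = tens_map \<phi> (rio_coprod (rio_y n))) \<and>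
    (\<forall>n. poly_counit (\<phi> (rio_y n)) = rio_counit (rio_y n))" (is "_ \<longleftrightarrow> ?R")
proof
  assume R: ?R
  have "(\<lambda>p. poly_coprod (\<phi> p)) = (\<lambda>p. tens_map \<phi> (rio_coprod p))"
    using R assms(2) rio_pi_in_FdB[where 'a = 'a]
    by (intro algebra_morphism_on_UNIV_ext[OF algebra_morphism_poly_coprod
          algebra_morphism_tens_map_coprod] assms(1))
      (auto simp: rio_bialgebra_morphism_on_def)
  moreover have "(\<lambda>p. poly_counit (\<phi> p)) = rio_counit"
    using R assms(2) rio_pi_in_FdB[where 'a = 'a]
    by (intro algebra_morphism_on_UNIV_ext[OF algebra_morphism_poly_counit
          algebra_morphism_rio_counit] assms(1))
      (auto simp: rio_bialgebra_morphism_on_def)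
  ultimately show "rio_bialgebra_morphism_on UNIV \<phi>"
    using assms(1) by (auto simp: rio_bialgebra_morphism_on_def fun_eq_iff)
qed (auto simp: rio_bialgebra_morphism_on_def)

section \<open>Applying \<phi> to power series\<close>

lemma rio_algebra_morphism_zero:
  assumes "rio_algebra_morphism_on UNIV \<phi>"
  shows "\<phi> 0 = 0"
  using assms unfolding rio_algebra_morphism_on_def algebra_morphism_on_def
  by (metis UNIV_I add_cancel_left_right)

lemma fps_map_coeffs_mult:
  assumes "rio_algebra_morphism_on UNIV \<phi>"
  shows "fps_map_coeffs \<phi> (A * B) = fps_map_coeffs \<phi> A * fps_map_coeffs \<phi> B"
proof -
  note \<phi> = assms[unfolded rio_algebra_morphism_on_def algebra_morphism_on_def, simplified]
  have "\<phi> (\<Sum>i\<in>S. h i) = (\<Sum>i\<in>S. \<phi> (h i))" for S :: "nat set" and h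
    using \<phi> by (induction S rule: infinite_finite_induct)
      (simp_all add: rio_algebra_morphism_zero[OF assms])
  then show ?thesis
    using \<phi> by (simp add: fps_eq_iff fps_map_coeffs_def fps_mult_nth)
qed

lemma fps_map_coeffs_power:
  assumes "rio_algebra_morphism_on UNIV \<phi>"
  shows "fps_map_coeffs \<phi> (A ^ n) = fps_map_coeffs \<phi> A ^ n"
proof (induction n)
  case 0
  have "\<phi> 1 = 1"
    using assms by (simp add: rio_algebra_morphism_on_def algebra_morphism_on_def)
  then show ?case
    by (simp add: fps_eq_iff fps_map_coeffs_def rio_algebra_morphism_zero[OF assms])
qed (simp add: fps_map_coeffs_mult[OF assms])

section \<open>Coproduct and counit in terms of F and \<Phi>\<close>

context
  fixes \<phi> :: "'k::field_char_0 rio \<Rightarrow> 'k poly" and F \<Phi> :: "'k poly fps"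
  assumes alg: "rio_algebra_morphism_on UNIV \<phi>"
    and F: "F = fps_map_coeffs \<phi> rio_Y" and \<Phi>: "\<Phi> = fps_map_coeffs \<phi> rio_Pi"
begin

lemma F_nth: "fps_nth F n = \<phi> (rio_y n)"
  by (simp add: F fps_map_coeffs_def rio_Y_def)

lemma Phi_nth_0: "fps_nth \<Phi> 0 = 0"
  by (simp add: \<Phi> fps_map_coeffs_def rio_Pi_def rio_algebra_morphism_zero[OF alg])

lemma Phi_nth_Suc: "fps_nth \<Phi> (Suc n) = \<phi> (rio_pi n)"
  by (simp add: \<Phi> fps_map_coeffs_def rio_Pi_def)

text \<open>This is the coefficient of \<open>x\<^sup>n L\<^sub>1\<^sup>i L\<^sub>2\<^sup>k\<close>
  in \<open>F(x, L\<^sub>1) F(\<Phi>(x, L\<^sub>1), L\<^sub>2)\<close>.\<close>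

lemma coeff_tens_coprod_y:
  "coeff (coeff (tens_map \<phi> (rio_coprod (rio_y n))) i) k =
    (\<Sum>j=0..n. fps_nth (fps_L_coeff i (F * \<Phi> ^ j)) n * fps_nth (fps_L_coeff k F) j)"
proof -
  have "F * \<Phi> ^ j = fps_map_coeffs \<phi> (rio_Y * rio_Pi ^ j)" for j
    by (simp add: F \<Phi> fps_map_coeffs_mult[OF alg] fps_map_coeffs_power[OF alg])
  then have "\<phi> (fps_nth (rio_Y * rio_Pi ^ j) n) = fps_nth (F * \<Phi> ^ j) n" for j
    by (simp add: fps_map_coeffs_def)
  then show ?thesis
    by (simp add: rio_coprod_y tens_map_sum tens_map_tens[OF alg] coeff_sum coeff_poly_tens F_nth)
qed

lemma coeff_tens_coprod_pi:
  "coeff (coeff (tens_map \<phi> (rio_coprod (rio_pi n))) i) k =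
    (\<Sum>j=0..n. fps_nth (fps_L_coeff i (\<Phi> ^ Suc j)) (Suc n) * fps_nth (fps_L_coeff k \<Phi>) (Suc j))"
proof -
  have "\<Phi> ^ Suc j = fps_map_coeffs \<phi> (rio_Pi ^ Suc j)" for j
    by (simp only: \<Phi> fps_map_coeffs_power[OF alg])
  then have "\<phi> (fps_nth (rio_Pi ^ Suc j) (Suc n)) = fps_nth (\<Phi> ^ Suc j) (Suc n)" for j
    by (simp add: fps_map_coeffs_def)
  then show ?thesis
    by (simp add: rio_coprod_pi tens_map_sum tens_map_tens[OF alg] coeff_sum coeff_poly_tens
        Phi_nth_Suc del: power_Suc)
qed

lemma initial_condition_iff_counit:
  "initial_condition F \<longleftrightarrow> (\<forall>n. poly_counit (\<phi> (rio_y n)) = rio_counit (rio_y n))"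
proof -
  have "rio_counit (rio_y n) = fps_nth (1::'k fps) n" for n
    using rio_counit_gen(2)[of n] algebra_morphism_rio_counit
    by (cases n) (auto simp: rio_y_def algebra_morphism_on_def)
  then show ?thesis
    by (simp add: initial_condition_def fps_eq_iff F_nth poly_counit_def poly_0_coeff_0)
qed

section \<open>Consequences of the morphism property on \<open>FdB\<close>\<close>

context
  fixes \<beta> :: "'k fps"
  assumes beta: "\<beta> = fps_L_coeff 1 \<Phi>" and FdB: "rio_bialgebra_morphism_on FdB \<phi>"
begin

lemma beta_nth_0: "fps_nth \<beta> 0 = 0"
  by (simp add: beta Phi_nth_0)

text \<open>The counit condition kills all \<pi> of positive index at L = 0 and leaves the leading
  term x.\<close>

lemma Phi_L_coeff_0: "fps_L_coeff 0 \<Phi> = fps_X"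
proof (rule fps_ext)
  fix n
  show "fps_nth (fps_L_coeff 0 \<Phi>) n = fps_nth fps_X n"
  proof (cases n)
    case (Suc m)
    have "poly_counit (\<phi> (rio_pi m)) = rio_counit (rio_pi m)"
      using FdB rio_pi_in_FdB by (auto simp: rio_bialgebra_morphism_on_def)
    also have "\<dots> = (if m = 0 then 1 else 0)"
      using rio_counit_gen(1)[of m] algebra_morphism_rio_counit
      by (cases m) (auto simp: rio_pi_def algebra_morphism_on_def)
    finally show ?thesis
      by (simp add: Suc Phi_nth_Suc poly_counit_def poly_0_coeff_0 fps_X_def)
  qed (simp add: Phi_nth_0)
qed

text \<open>Modulo L^2, \<Phi> = x + \<beta> L, so the linear term of \<Phi>^j is \<beta>
  (x^j)'.\<close>

lemma Phi_power_L_coeff_1: "fps_L_coeff 1 (\<Phi> ^ j) = rge_op \<beta> 0 (fps_X ^ j)"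
proof (cases j)
  case 0
  then show ?thesis by (simp add: rge_op_def fps_eq_iff)
next
  case (Suc m)
  then show ?thesis
    using fps_L_coeff_1_power[of \<Phi> m] fps_deriv_power[of "fps_X :: 'k fps" "Suc m"]
    by (simp add: rge_op_def beta Phi_L_coeff_0 mult_ac flip: fps_of_nat del: power_Suc of_nat_Suc)
qed

lemma RGE_Phi: "RGE \<beta> 0 \<Phi>"
  unfolding RGE_iff
proof (intro allI fps_ext)
  fix k n
  show "fps_nth (of_nat (Suc k) * fps_L_coeff (Suc k) \<Phi>) n =
      fps_nth (rge_op \<beta> 0 (fps_L_coeff k \<Phi>)) n"
  proof (cases n)
    case 0
    then show ?thesis
      by (simp add: Phi_nth_0 rge_op_def beta_nth_0)
  next
    case (Suc m)
    have "poly_coprod (\<phi> (rio_pi m)) = tens_map \<phi> (rio_coprod (rio_pi m))"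
      using FdB rio_pi_in_FdB by (auto simp: rio_bialgebra_morphism_on_def)
    then have "of_nat (Suc k) * coeff (\<phi> (rio_pi m)) (Suc k) =
        coeff (coeff (tens_map \<phi> (rio_coprod (rio_pi m))) 1) k"
      using coeff_poly_coprod[of "\<phi> (rio_pi m)" 1 k] by simp
    also have "\<dots> = (\<Sum>j=0..m. fps_nth (rge_op \<beta> 0 (fps_X ^ Suc j)) (Suc m) *
        fps_nth (fps_L_coeff k \<Phi>) (Suc j))"
      by (simp only: coeff_tens_coprod_pi Phi_power_L_coeff_1)
    \<comment> \<open>The coproduct has only powers from 1 on; the added term j = 0 vanishes because
      \<Phi> has no constant term in x.\<close>
    also have "\<dots> = (\<Sum>j=0..Suc m. fps_nth (rge_op \<beta> 0 (fps_X ^ j)) (Suc m) *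
        fps_nth (fps_L_coeff k \<Phi>) j)"
      by (simp add: sum.atLeast0_atMost_Suc_shift Phi_nth_0 del: power_Suc sum.cl_ivl_Suc)
    also have "\<dots> = fps_nth (rge_op \<beta> 0 (fps_L_coeff k \<Phi>)) (Suc m)"
      by (rule rge_op_nth[OF beta_nth_0, symmetric])
    finally show ?thesis
      by (simp add: Suc Phi_nth_Suc fps_mult_of_nat_nth del: of_nat_Suc)
  qed
qed

section \<open>The two implications\<close>

lemma RGE_if_coprod_y:
  assumes init: "initial_condition F"
    and coprod: "\<And>n. poly_coprod (\<phi> (rio_y n)) = tens_map \<phi> (rio_coprod (rio_y n))"
  shows "RGE \<beta> (fps_L_coeff 1 F) F"
  unfolding RGE_iff
proof (intro allI fps_ext)
  fix k n
  let ?D = "rge_op \<beta> (fps_L_coeff 1 F)"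
  \<comment> \<open>Modulo L^2, F = 1 + \<gamma> L by the initial condition, so the linear term of
    the product is \<beta> (x^j)' + \<gamma> x^j.\<close>
  have "fps_L_coeff 1 (F * \<Phi> ^ j) = ?D (fps_X ^ j)" for j
    using init Phi_power_L_coeff_1[of j]
    by (simp add: fps_L_coeff_1_mult fps_L_coeff_0_power Phi_L_coeff_0 initial_condition_def
        rge_op_def)
  then have "coeff (coeff (poly_coprod (\<phi> (rio_y n))) 1) k =
      (\<Sum>j=0..n. fps_nth (?D (fps_X ^ j)) n * fps_nth (fps_L_coeff k F) j)"
    by (simp only: coprod coeff_tens_coprod_y)
  also have "\<dots> = fps_nth (?D (fps_L_coeff k F)) n"
    by (rule rge_op_nth[OF beta_nth_0, symmetric])
  finally show "fps_nth (of_nat (Suc k) * fps_L_coeff (Suc k) F) n = fps_nth (?D (fps_L_coeff k F)) n"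
    by (simp add: coeff_poly_coprod F_nth fps_mult_of_nat_nth del: of_nat_Suc)
qed

lemma coprod_y_if_RGE:
  assumes init: "initial_condition F" and RGE: "RGE \<beta> \<gamma> F"
  shows "poly_coprod (\<phi> (rio_y n)) = tens_map \<phi> (rio_coprod (rio_y n))"
proof (intro poly_eqI)
  fix i k
  let ?D = "rge_op \<beta> \<gamma>"
  \<comment> \<open>F \<Phi>^j solves the same equation and starts from x^j at L = 0.\<close>
  have fact_coeff: "(?D ^^ i) (fps_X ^ j) = fps_const (fact i) * fps_L_coeff i (F * \<Phi> ^ j)" for j
    using RGE_L_coeff_add[OF RGE_mult_power[OF RGE RGE_Phi, of j], of i 0] init
    by (simp add: fps_L_coeff_0_mult fps_L_coeff_0_power Phi_L_coeff_0 initial_condition_def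
        pochhammer_fact)
  \<comment> \<open>The series D^i applied to the coefficient of L^k in F is computed twice: by the
    recursion for F, then by the matrix of D^i.\<close>
  have "pochhammer (of_nat (Suc k)) i * fps_nth (fps_L_coeff (i + k) F) n =
      fps_nth ((?D ^^ i) (fps_L_coeff k F)) n"
    by (simp add: RGE_L_coeff_add[OF RGE])
  also have "\<dots> = fact i * coeff (coeff (tens_map \<phi> (rio_coprod (rio_y n))) i) k"
    by (subst rge_op_pow_nth[OF beta_nth_0])
      (simp add: fact_coeff coeff_tens_coprod_y sum_distrib_left mult.assoc)
  finally have "pochhammer (of_nat (Suc k)) i * coeff (\<phi> (rio_y n)) (i + k) =
      fact i * coeff (coeff (tens_map \<phi> (rio_coprod (rio_y n))) i) k"
    by (simp add: F_nth)
  \<comment> \<open>This turns the product (k + 1) ... (k + i) into the binomial of \<Delta>L^(i +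
    k); characteristic 0 allows cancelling the factorials.\<close>
  moreover have "pochhammer (of_nat (Suc k)) i = (fact i * of_nat ((i + k) choose i) :: 'k)"
  proof -
    have "fact k * pochhammer (of_nat (Suc k)) i = (fact (k + i) :: 'k)"
      using pochhammer_product'[of "1::'k" k i] by (simp add: pochhammer_fact)
    also have "\<dots> = fact k * (fact i * of_nat ((i + k) choose i))"
      by (simp add: binomial_fact add.commute)
    finally show ?thesis by simp
  qed
  ultimately show "coeff (coeff (poly_coprod (\<phi> (rio_y n))) i) k =
      coeff (coeff (tens_map \<phi> (rio_coprod (rio_y n))) i) k"
    by (simp add: coeff_poly_coprod mult.assoc)
qed

end

end

theorem theorem2p22:
  fixes \<phi> :: "'k::field_char_0 rio \<Rightarrow> 'k poly"
    and F \<Phi> :: "'k poly fps" and \<beta> \<gamma> :: "'k fps"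
  assumes "rio_algebra_morphism_on UNIV \<phi>"
    and "F = fps_map_coeffs \<phi> rio_Y"
    and "\<Phi> = fps_map_coeffs \<phi> rio_Pi"
    and "\<beta> = fps_L_coeff 1 \<Phi>"
    and "\<gamma> = fps_L_coeff 1 F"
    and "rio_bialgebra_morphism_on FdB \<phi>"
  shows "rio_bialgebra_morphism_on UNIV \<phi> \<longleftrightarrow> initial_condition F \<and> RGE \<beta> \<gamma> F"
  using RGE_if_coprod_y[OF assms(1-4,6)] coprod_y_if_RGE[OF assms(1-4,6)]
  by (auto simp: rio_bialgebra_morphism_on_UNIV_iff[OF assms(1,6)] assms(5)
      simp flip: initial_condition_iff_counit[OF assms(1,2)])

end
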